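(* Let $X$ be a real topological linear space, $Z$ a non-trivial real locally convex linear space, $C\subseteq Z$ a convex cone with $0 \in C$. Let $f \colon X \to \mathcal G(Z,C)$ and $\bar x \in \operatorname{dom} f$ be such that $f$ is lattice-lower semicontinuous at $\bar x$. Then $$\liminf_{x \to \bar x} f(x) = \Big\{z \in Z \;\Big|\; \forall z^* \in C^+\setminus\{0\} \colon \liminf_{x \to \bar x}\varphi_{f, z^*}(x) \leq z^*(z)\Big\}.$$
   Context: $C^+ = \{z^* \in Z^* \mid \forall z \in C\colon z^*(z)\ge 0\}$. $\mathcal G(Z,C) = \{A \subseteq Z \mid A = \operatorname{cl}\operatorname{co}(A+C)\}$ (containing $\emptyset$ and $Z$). $\operatorname{dom} f = \{x \mid f(x)\neq\emptyset\}$. $\varphi_{f,z^*}\colon X \to \mathbb R\cup\{\pm\infty\}$ is $\varphi_{f,z^*}(x) = \inf_{z\in f(x)} z^*(z)$ (with $\inf\emptyset=+\infty$). With $\mathcal N_X$ a neighborhood base of $0\in X$, the set-valued limit inferior (taken in $\mathcal G(Z,C)$ ordered by $\supseteq$) is $\liminf_{x\to\bar x} f(x) = \sup_{U\in\mathcal N_X}\inf_{x\in\bar x+U} f(x) = \bigcap_{U \in \mathcal N_X}\operatorname{cl}\operatorname{co}\bigcup_{x\in\bar x+U} f(x)$, and the scalar one is $\liminf_{x\to\bar x}\varphi(x) = \sup_{U\in\mathcal N_X}\inf_{x\in \bar x+U}\varphi(x)$ ($x=\bar x$ is included). $f$ is lattice-lower semicontinuous at $\bar x$ if $f(\bar x)\supseteq\liminf_{x\to\bar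 x} f(x)$. *)

theory Defs
  imports "HOL-Analysis.Analysis"
begin

(* Topological linear spaces are not assumed to be Hausdorff. *)

class real_tvs = real_vector + topological_ab_group_add +
  assumes tendsto_scaleR_Pair:
    "LIM p (nhds r \<times>\<^sub>F nhds a). scaleR (fst p) (snd p) :> nhds (scaleR r a)"

(* Convexity of V is spelled out because the constant convex, being restricted to
   class real_vector, cannot occur in a class specification; see convex_nhds_zero. *)
class real_lctvs = real_tvs +
  assumes locally_convex:
    "eventually (\<lambda>z. z \<in> U) (nhds 0) \<Longrightarrow>
      \<exists>V. (\<forall>x\<in>V. \<forall>y\<in>V. \<forall>u\<ge>0. \<forall>v\<ge>0. u + v = 1 \<longrightarrow> scaleR u x + scaleR v y \<in> V) \<and>
          eventually (\<lambda>z. z \<in> V) (nhds 0) \<and> V \<subseteq> U"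

lemma convex_nhds_zero:
  fixes U :: "'z::real_lctvs set"
  assumes "eventually (\<lambda>z. z \<in> U) (nhds 0)"
  shows "\<exists>V. convex V \<and> eventually (\<lambda>z. z \<in> V) (nhds 0) \<and> V \<subseteq> U"
  using locally_convex[OF assms] unfolding convex_def .

instance real_normed_vector < real_lctvs
proof
  fix r :: real and a :: 'a
  show "LIM p (nhds r \<times>\<^sub>F nhds a). scaleR (fst p) (snd p) :> nhds (scaleR r a)"
    by (intro tendsto_scaleR filterlim_fst filterlim_snd)
next
  fix U :: "'a set"
  assume "eventually (\<lambda>z. z \<in> U) (nhds 0)"
  then obtain e where "e > 0" "ball 0 e \<subseteq> U"
    by (auto simp: eventually_nhds_metric dist_commute subset_iff)
  then show "\<exists>V. (\<forall>x\<in>V. \<forall>y\<in>V. \<forall>u\<ge>0. \<forall>v\<ge>0. u + v = 1 \<longrightarrow> u *\<^sub>R x + v *\<^sub>R y \<in> V) \<and>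
      eventually (\<lambda>z. z \<in> V) (nhds 0) \<and> V \<subseteq> U"
    unfolding convex_def[symmetric]
    by (intro exI[of _ "ball 0 e"]) (auto simp: eventually_nhds_metric)
qed

(* Neighborhoods need not be open. *)
definition nhd_base_zero :: "'x::real_tvs set set \<Rightarrow> bool" where
  "nhd_base_zero N \<longleftrightarrow>
    (\<forall>U\<in>N. eventually (\<lambda>x. x \<in> U) (nhds 0)) \<and>
    (\<forall>V. eventually (\<lambda>x. x \<in> V) (nhds 0) \<longrightarrow> (\<exists>U\<in>N. U \<subseteq> V))"

definition topological_dual :: "('z::real_tvs \<Rightarrow> real) set" where
  "topological_dual = {zs. linear zs \<and> continuous_on UNIV zs}"

definition dual_cone :: "'z::real_tvs set \<Rightarrow> ('z \<Rightarrow> real) set" where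
  "dual_cone C = {zs \<in> topological_dual. \<forall>z\<in>C. 0 \<le> zs z}"

(* A + C is the Minkowski sum, so {} + C = {}. *)
definition closed_convex_lattice :: "'z::real_tvs set \<Rightarrow> 'z set set" where
  "closed_convex_lattice C = {A. A = closure (convex hull (A + C))}"

definition domain_of :: "('x \<Rightarrow> 'z set) \<Rightarrow> 'x set" where
  "domain_of f = {x. f x \<noteq> {}}"

(* The infimum is taken in ereal, where the infimum of the empty set is \<infinity>. *)
definition scalarization :: "('x \<Rightarrow> 'z set) \<Rightarrow> ('z \<Rightarrow> real) \<Rightarrow> 'x \<Rightarrow> ereal" where
  "scalarization f zs x = (INF z\<in>f x. ereal (zs z))"

(* In the lattice of closed convex sets ordered by reverse inclusion, the supremum
   is the intersection and the infimum is the closed convex hull of the union.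
   In both limits N is meant to be a neighborhood base of 0, and the point x0
   itself is not excluded. *)
definition set_liminf ::
    "'x::real_tvs set set \<Rightarrow> ('x \<Rightarrow> 'z::real_tvs set) \<Rightarrow> 'x \<Rightarrow> 'z set" where
  "set_liminf N f x0 = (\<Inter>U\<in>N. closure (convex hull (\<Union>x\<in>(+) x0 ` U. f x)))"

definition scalar_liminf ::
    "'x::real_tvs set set \<Rightarrow> ('x \<Rightarrow> ereal) \<Rightarrow> 'x \<Rightarrow> ereal" where
  "scalar_liminf N g x0 = (SUP U\<in>N. INF x\<in>(+) x0 ` U. g x)"

definition lattice_lsc_at ::
    "'x::real_tvs set set \<Rightarrow> ('x \<Rightarrow> 'z::real_tvs set) \<Rightarrow> 'x \<Rightarrow> bool" where
  "lattice_lsc_at N f x0 \<longleftrightarrow> set_liminf N f x0 \<subseteq> f x0"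

end

theory Submission
  imports Defs
begin

text \<open>Lower semicontinuity together with \<open>0 \<in> U\<close> for every neighbourhood \<open>U\<close> collapses the
  set-valued limit inferior to \<open>f x0\<close>, which gives one inclusion. For the other one, a point outside
  the closed convex hull of some \<open>\<Union>x\<in>x0 + U. f x\<close> is strictly separated from it by a continuous
  linear functional; invariance of \<open>f x0\<close> under adding \<open>C\<close> places this functional in the
  dual cone. Separation rests on the Hahn-Banach theorem, obtained here from the
  fact that minimal sublinear functionals are linear.\<close>

section \<open>Sublinear functionals\<close>

definition sublinear :: "('a::real_vector \<Rightarrow> real) \<Rightarrow> bool" where
  "sublinear p \<longleftrightarrow> (\<forall>x y. p (x + y) \<le> p x + p y) \<and> (\<forall>t\<ge>0. \<forall>x. p (t *\<^sub>R x) = t * p x)"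

text \<open>Applying \<open>scale\<close> to \<open>inverse t\<close> and
  \<open>t *\<^sub>R x\<close> gives the reverse inequality, so a one-sided check for positive
  factors is enough.\<close>

lemma sublinearI:
  fixes p :: "'a::real_vector \<Rightarrow> real"
  assumes add: "\<And>x y. p (x + y) \<le> p x + p y"
    and scale: "\<And>t x. t > 0 \<Longrightarrow> p (t *\<^sub>R x) \<le> t * p x"
    and zero: "p 0 = 0"
  shows "sublinear p"
  unfolding sublinear_def
proof (intro conjI allI impI)
  fix t :: real and x
  assume "t \<ge> 0"
  show "p (t *\<^sub>R x) = t * p x"
  proof (cases "t = 0")
    case False
    with \<open>t \<ge> 0\<close> have t: "t > 0" by simp
    have "p x \<le> inverse t * p (t *\<^sub>R x)"
      using scale[of "inverse t" "t *\<^sub>R x"] t by simp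
    with t have "t * p x \<le> p (t *\<^sub>R x)"
      by (simp add: field_simps)
    with scale[OF t] show ?thesis by (simp add: antisym)
  qed (simp add: zero)
qed (rule add)

lemma sublinear_add: "sublinear p \<Longrightarrow> p (x + y) \<le> p x + p y"
  and sublinear_scale: "sublinear p \<Longrightarrow> t \<ge> 0 \<Longrightarrow> p (t *\<^sub>R x) = t * p x"
  by (auto simp: sublinear_def)

lemma sublinear_zero: "sublinear p \<Longrightarrow> p 0 = 0"
  using sublinear_scale[of p 0 0] by simp

lemma sublinear_minus_ge: "sublinear p \<Longrightarrow> - p (- x) \<le> p x"
  using sublinear_add[of p x "- x"] sublinear_zero[of p] by simp

text \<open>With \<open>sublinear_minus_ge\<close>, the hypothesis \<open>odd\<close> becomes an
  equality; subadditivity at \<open>- x\<close> and \<open>- y\<close> then reads as superadditivity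
  at \<open>x\<close> and \<open>y\<close>.\<close>

lemma sublinear_odd_imp_linear:
  assumes "sublinear p" and odd: "\<And>x. p (- x) \<le> - p x"
  shows "linear p"
proof -
  have minus: "p (- x) = - p x" for x
    using odd[of x] sublinear_minus_ge[OF assms(1), of x] by simp
  show ?thesis
  proof (rule linearI)
    fix x y
    have "p (- x + - y) \<le> p (- x) + p (- y)"
      by (rule sublinear_add[OF assms(1)])
    then have "p x + p y \<le> p (x + y)"
      using minus[of "x + y"] by (simp add: minus)
    then show "p (x + y) = p x + p y"
      using sublinear_add[OF assms(1), of x y] by simp
  next
    fix r :: real and x
    show "p (r *\<^sub>R x) = r *\<^sub>R p x"
    proof (cases "r \<ge> 0")
      case True
      then show ?thesis by (simp add: sublinear_scale[OF assms(1)])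
    next
      case False
      then have "p ((- r) *\<^sub>R x) = - r * p x"
        by (intro sublinear_scale[OF assms(1)]) simp
      then show ?thesis using minus[of "r *\<^sub>R x"] by simp
    qed
  qed
qed

text \<open>Lowering \<open>p\<close> along the ray through \<open>y\<close> forces the value at
  \<open>- y\<close> down to \<open>- p y\<close>. A minimal sublinear functional cannot be lowered,
  hence is odd; the same \<open>q\<close> later yields a functional touching \<open>p\<close> at
  \<open>y\<close>.\<close>

lemma sublinear_lower_at:
  fixes p :: "'a::real_vector \<Rightarrow> real"
  assumes p: "sublinear p"
  obtains q where "sublinear q" "\<And>x. q x \<le> p x" "q (- y) \<le> - p y"
proof
  define g where "g x t = p (x + t *\<^sub>R y) - t * p y" for x t
  define q where "q x = (INF t\<in>{0..}. g x t)" for x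
  \<comment> \<open>This bound does not depend on \<open>t\<close>, so the real infimum defining
    \<open>q x\<close> is a genuine one.\<close>
  have lower: "- p (- x) \<le> g x t" if "t \<ge> 0" for x t
    using sublinear_add[OF p, of "x + t *\<^sub>R y" "- x"] sublinear_scale[OF p that, of y]
    by (simp add: g_def)
  have q_le: "q x \<le> g x t" if "t \<ge> 0" for x t
    unfolding q_def using that lower
    by (intro cINF_lower bdd_belowI2[where m = "- p (- x)"]) auto
  have q_ge: "m \<le> q x" if "\<And>t. t \<ge> 0 \<Longrightarrow> m \<le> g x t" for m x
    unfolding q_def using that by (intro cINF_greatest) auto
  show "q x \<le> p x" for x
    using q_le[of 0 x] by (simp add: g_def)
  show "q (- y) \<le> - p y"
    using q_le[of 1 "- y"] sublinear_zero[OF p] by (simp add: g_def)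
  show "sublinear q"
  proof (rule sublinearI)
    fix x z
    have *: "q (x + z) \<le> g x s + g z t" if "s \<ge> 0" "t \<ge> 0" for s t
    proof -
      have "q (x + z) \<le> g (x + z) (s + t)"
        using that by (intro q_le) simp
      also have "\<dots> \<le> g x s + g z t"
        using sublinear_add[OF p, of "x + s *\<^sub>R y" "z + t *\<^sub>R y"]
        by (simp add: g_def algebra_simps)
      finally show ?thesis .
    qed
    \<comment> \<open>The two parameters are eliminated one after the other: first the infimum over
      \<open>t\<close> with \<open>s\<close> fixed, then the infimum over \<open>s\<close>.\<close>
    have "q (x + z) - g x s \<le> q z" if "s \<ge> 0" for s
      using *[OF that] by (intro q_ge) (simp add: algebra_simps)
    then have "q (x + z) - q z \<le> q x"
      by (intro q_ge) (simp add: algebra_simps)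
    then show "q (x + z) \<le> q x + q z" by simp
  next
    fix r :: real and x
    assume r: "r > 0"
    have "q (r *\<^sub>R x) / r \<le> g x t" if "t \<ge> 0" for t
    proof -
      have "q (r *\<^sub>R x) \<le> g (r *\<^sub>R x) (r * t)"
        using r that by (intro q_le) simp
      also have "\<dots> = r * g x t"
        using sublinear_scale[OF p, of r "x + t *\<^sub>R y"] r
        by (simp add: g_def algebra_simps)
      finally show ?thesis using r by (simp add: field_simps)
    qed
    then have "q (r *\<^sub>R x) / r \<le> q x" by (rule q_ge)
    then show "q (r *\<^sub>R x) \<le> r * q x" using r by (simp add: field_simps)
  next
    have "g 0 t = 0" if "t \<ge> 0" for t
      using sublinear_scale[OF p that] by (simp add: g_def)
    then show "q 0 = 0"
      unfolding q_def by (subst INF_cong[OF refl, where D = "\<lambda>_. 0"]) auto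
  qed
qed

text \<open>Supplies the lower bounds of chains for Zorn's lemma. Comparability enters twice: it
  bounds the infimum from below at each point, and it replaces two members by the smaller one in the
  proof of subadditivity.\<close>

lemma sublinear_INF_chain:
  fixes Q :: "('a::real_vector \<Rightarrow> real) set"
  assumes "Q \<noteq> {}" and sub: "\<And>q. q \<in> Q \<Longrightarrow> sublinear q"
    and chain: "\<And>q r. q \<in> Q \<Longrightarrow> r \<in> Q \<Longrightarrow> q \<le> r \<or> r \<le> q"
  shows "sublinear (\<lambda>x. INF q\<in>Q. q x)" and "\<And>q. q \<in> Q \<Longrightarrow> (\<lambda>x. INF q\<in>Q. q x) \<le> q"
proof -
  obtain p where "p \<in> Q" using assms(1) by blast
  have lower: "- p (- x) \<le> q x" if "q \<in> Q" for q x
  proof -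
    have "- p (- x) \<le> p x" "- q (- x) \<le> q x"
      using sublinear_minus_ge sub \<open>p \<in> Q\<close> that by blast+
    \<comment> \<open>If \<open>p\<close> is the smaller one, compare at \<open>x\<close>; if
      \<open>q\<close> is, compare at \<open>- x\<close> and use
      \<open>- q (- x) \<le> q x\<close>.\<close>
    moreover have "p x \<le> q x \<or> q (- x) \<le> p (- x)"
      using chain[OF \<open>p \<in> Q\<close> that] by (auto simp: le_fun_def)
    ultimately show ?thesis by linarith
  qed
  have INF_le: "(INF q\<in>Q. q x) \<le> q x" if "q \<in> Q" for q x
    using that lower by (intro cINF_lower bdd_belowI2[where m = "- p (- x)"])
  have INF_ge: "m \<le> (INF q\<in>Q. q x)" if "\<And>q. q \<in> Q \<Longrightarrow> m \<le> q x" for m x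
    using that assms(1) by (intro cINF_greatest)
  show "(\<lambda>x. INF q\<in>Q. q x) \<le> q" if "q \<in> Q" for q
    using INF_le[OF that] by (rule le_funI)
  show "sublinear (\<lambda>x. INF q\<in>Q. q x)"
  proof (rule sublinearI)
    fix x y
    have *: "(INF q\<in>Q. q (x + y)) \<le> q x + r y" if qr: "q \<in> Q" "r \<in> Q" for q r
    proof -
      obtain s where s: "s \<in> Q" "s \<le> q" "s \<le> r"
        using chain[OF qr] qr by blast
      have "(INF q\<in>Q. q (x + y)) \<le> s (x + y)" by (rule INF_le[OF s(1)])
      also have "\<dots> \<le> s x + s y" by (rule sublinear_add[OF sub[OF s(1)]])
      also have "\<dots> \<le> q x + r y" using s(2,3) by (simp add: le_fun_def add_mono)
      finally show ?thesis .
    qed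
    have "(INF q\<in>Q. q (x + y)) - q x \<le> (INF q\<in>Q. q y)" if "q \<in> Q" for q
      using *[OF that] by (intro INF_ge) (simp add: algebra_simps)
    then have "(INF q\<in>Q. q (x + y)) - (INF q\<in>Q. q y) \<le> (INF q\<in>Q. q x)"
      by (intro INF_ge) (simp add: algebra_simps)
    then show "(INF q\<in>Q. q (x + y)) \<le> (INF q\<in>Q. q x) + (INF q\<in>Q. q y)" by simp
  next
    fix t :: real and x
    assume t: "t > 0"
    have "(INF q\<in>Q. q (t *\<^sub>R x)) / t \<le> q x" if "q \<in> Q" for q
      using INF_le[OF that, of "t *\<^sub>R x"] sublinear_scale[OF sub[OF that], of t x] t
      by (simp add: field_simps)
    then have "(INF q\<in>Q. q (t *\<^sub>R x)) / t \<le> (INF q\<in>Q. q x)" by (rule INF_ge)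
    then show "(INF q\<in>Q. q (t *\<^sub>R x)) \<le> t * (INF q\<in>Q. q x)"
      using t by (simp add: field_simps)
  next
    show "(INF q\<in>Q. q 0) = 0"
      using assms(1) sublinear_zero[OF sub]
      by (subst INF_cong[OF refl, where D = "\<lambda>_. 0"]) auto
  qed
qed

text \<open>Zorn's lemma is applied to the reversed pointwise order, so the element obtained is
  minimal among the sublinear functionals below \<open>p\<close>; by
  \<open>sublinear_lower_at\<close> it is odd, hence linear.\<close>

theorem Hahn_Banach_sublinear:
  fixes p :: "'a::real_vector \<Rightarrow> real"
  assumes "sublinear p"
  obtains F where "linear F" "\<And>x. F x \<le> p x"
proof -
  define A where "A = {q. sublinear q \<and> q \<le> p}"
  have "\<exists>m\<in>A. \<forall>q\<in>A. q \<le> m \<longrightarrow> q = m"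
  proof (rule predicate_Zorn)
    show "partial_order_on A (relation_of (\<lambda>q r. r \<le> q) A)"
      by (rule partial_order_on_relation_ofI) auto
  next
    fix Q
    assume "Q \<in> Chains (relation_of (\<lambda>q r. r \<le> q) A)"
    then have Q: "Q \<subseteq> A" "\<And>q r. q \<in> Q \<Longrightarrow> r \<in> Q \<Longrightarrow> q \<le> r \<or> r \<le> q"
      by (auto simp: Chains_def relation_of_def)
    show "\<exists>u\<in>A. \<forall>q\<in>Q. u \<le> q"
    \<comment> \<open>The real infimum over an empty family carries no information, so the empty
      chain is bounded by \<open>p\<close> itself.\<close>
    proof (cases "Q = {}")
      case True
      then show ?thesis using assms by (auto simp: A_def)
    next
      case False
      have sub: "sublinear q" "q \<le> p" if "q \<in> Q" for q
        using that Q(1) by (auto simp: A_def)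
      note inf = sublinear_INF_chain[OF False sub(1) Q(2)]
      obtain q where "q \<in> Q" using False by blast
      with inf(2) sub(2) have "(\<lambda>x. INF q\<in>Q. q x) \<le> p" by (blast intro: order_trans)
      with inf show ?thesis
        unfolding A_def by (intro bexI[of _ "\<lambda>x. INF q\<in>Q. q x"]) auto
    qed
  qed
  then obtain m where m: "sublinear m" "m \<le> p"
    and minimal: "\<And>q. sublinear q \<Longrightarrow> q \<le> m \<Longrightarrow> q = m"
    unfolding A_def by (auto intro: order_trans)
  have "m (- y) \<le> - m y" for y
  proof -
    obtain q where q: "sublinear q" "\<And>x. q x \<le> m x" "q (- y) \<le> - m y"
      using sublinear_lower_at[OF m(1), of y] by blast
    from minimal[OF q(1)] q(2) have "q = m" by (simp add: le_fun_def)
    with q(3) show ?thesis by simp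
  qed
  with m(1) have "linear m" by (rule sublinear_odd_imp_linear)
  with m(2) that show thesis by (auto simp: le_fun_def)
qed

text \<open>A linear functional below the lowered \<open>q\<close> satisfies
  \<open>F (- y) \<le> - p y\<close>, that is \<open>p y \<le> F y\<close>, which is the missing
  half of the equality at \<open>y\<close>.\<close>

corollary Hahn_Banach_supporting:
  fixes p :: "'a::real_vector \<Rightarrow> real"
  assumes "sublinear p"
  obtains F where "linear F" "\<And>x. F x \<le> p x" "F y = p y"
proof -
  obtain q where q: "sublinear q" "\<And>x. q x \<le> p x" "q (- y) \<le> - p y"
    using sublinear_lower_at[OF assms, of y] by blast
  obtain F where F: "linear F" "\<And>x. F x \<le> q x"
    using Hahn_Banach_sublinear[OF q(1)] by blast
  have le: "F x \<le> p x" for x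
    using F(2)[of x] q(2)[of x] by simp
  have "- F y \<le> - p y"
    using F(2)[of "- y"] q(3) linear_neg[OF F(1), of y] by simp
  with le[of y] have "F y = p y" by simp
  with F(1) le that show thesis by blast
qed

section \<open>The Minkowski functional\<close>

definition minkowski :: "'a::real_vector set \<Rightarrow> 'a \<Rightarrow> real" where
  "minkowski K x = Inf {t. t > 0 \<and> inverse t *\<^sub>R x \<in> K}"

lemma minkowski_le: "t > 0 \<Longrightarrow> inverse t *\<^sub>R x \<in> K \<Longrightarrow> minkowski K x \<le> t"
  unfolding minkowski_def by (rule cInf_lower) (auto intro: bdd_belowI[of _ 0])

lemma sublinear_minkowski:
  fixes K :: "'a::real_vector set"
  assumes "convex K" and absorbing: "\<And>x. \<exists>t>0. inverse t *\<^sub>R x \<in> K"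
  shows "sublinear (minkowski K)"
proof (rule sublinearI)
  have ge: "m \<le> minkowski K x" if "\<And>t. t > 0 \<Longrightarrow> inverse t *\<^sub>R x \<in> K \<Longrightarrow> m \<le> t" for m x
    unfolding minkowski_def using absorbing[of x] that by (intro cInf_greatest) auto
  fix x y
  have *: "minkowski K (x + y) \<le> s + t"
    if "s > 0" "inverse s *\<^sub>R x \<in> K" "t > 0" "inverse t *\<^sub>R y \<in> K" for s t
  proof (rule minkowski_le)
    \<comment> \<open>These weights make the convex combination equal to
      \<open>inverse (s + t) *\<^sub>R (x + y)\<close>.\<close>
    have "(s / (s + t)) *\<^sub>R inverse s *\<^sub>R x + (t / (s + t)) *\<^sub>R inverse t *\<^sub>R y \<in> K"
      using that by (intro convexD[OF assms(1)]) (auto simp: add_divide_distrib[symmetric])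
    then show "inverse (s + t) *\<^sub>R (x + y) \<in> K"
      using that by (simp add: scaleR_add_right inverse_eq_divide)
  qed (use that in simp)
  have "minkowski K (x + y) - s \<le> minkowski K y" if "s > 0" "inverse s *\<^sub>R x \<in> K" for s
    using *[OF that] by (intro ge) (simp add: algebra_simps)
  then have "minkowski K (x + y) - minkowski K y \<le> minkowski K x"
    by (intro ge) (simp add: algebra_simps)
  then show "minkowski K (x + y) \<le> minkowski K x + minkowski K y" by simp
  fix r :: real
  assume r: "r > 0"
  have "minkowski K (r *\<^sub>R x) / r \<le> t" if "t > 0" "inverse t *\<^sub>R x \<in> K" for t
  proof -
    have "minkowski K (r *\<^sub>R x) \<le> r * t"
      using that r by (intro minkowski_le) (simp_all add: field_simps)
    then show ?thesis using r by (simp add: field_simps)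
  qed
  then have "minkowski K (r *\<^sub>R x) / r \<le> minkowski K x" by (rule ge)
  then show "minkowski K (r *\<^sub>R x) \<le> r * minkowski K x"
    using r by (simp add: field_simps)
next
  have "0 \<in> K" using absorbing[of 0] by simp
  then have "{t. t > 0 \<and> inverse t *\<^sub>R 0 \<in> K} = {0<..}" by auto
  then show "minkowski K 0 = 0" by (simp add: minkowski_def)
qed

text \<open>An admissible \<open>t < 1\<close> would exhibit \<open>x\<close> as a convex
  combination of \<open>inverse t *\<^sub>R x\<close> and \<open>0\<close>, both in
  \<open>K\<close>.\<close>

lemma minkowski_ge_one:
  assumes "convex K" "0 \<in> K" "x \<notin> K" and absorbing: "\<exists>t>0. inverse t *\<^sub>R x \<in> K"
  shows "1 \<le> minkowski K x"
  unfolding minkowski_def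
proof (rule cInf_greatest)
  fix t
  assume t: "t \<in> {t. t > 0 \<and> inverse t *\<^sub>R x \<in> K}"
  show "1 \<le> t"
  proof (rule ccontr)
    assume "\<not> 1 \<le> t"
    with t assms(2) have "t *\<^sub>R inverse t *\<^sub>R x + (1 - t) *\<^sub>R 0 \<in> K"
      by (intro convexD[OF assms(1)]) auto
    with t assms(3) show False by simp
  qed
qed (use absorbing in auto)

section \<open>Separation in locally convex spaces\<close>

lemma tendsto_scaleR_tvs:
  fixes x :: "'a::real_tvs"
  assumes "(f \<longlongrightarrow> r) F" "(g \<longlongrightarrow> x) F"
  shows "((\<lambda>w. f w *\<^sub>R g w) \<longlongrightarrow> r *\<^sub>R x) F"
  using filterlim_compose[OF tendsto_scaleR_Pair filterlim_Pair[OF assms]] by simp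

text \<open>Scalar multiplication is continuous in the scalar, so
  \<open>inverse t *\<^sub>R x\<close> tends to \<open>0\<close> as \<open>t\<close> grows.\<close>

lemma eventually_nhds_zero_absorbing:
  fixes V :: "'a::real_tvs set"
  assumes "eventually (\<lambda>v. v \<in> V) (nhds 0)"
  shows "\<exists>t>0. inverse t *\<^sub>R x \<in> V"
proof -
  have "((\<lambda>t::real. inverse t *\<^sub>R x) \<longlongrightarrow> 0 *\<^sub>R x) at_top"
    by (intro tendsto_scaleR_tvs tendsto_inverse_0_at_top filterlim_ident tendsto_const)
  then have "eventually (\<lambda>t::real. inverse t *\<^sub>R x \<in> V) at_top"
    using assms by (auto dest: filterlim_iff[THEN iffD1])
  with eventually_gt_at_top[of "0::real"]
  have "eventually (\<lambda>t. t > 0 \<and> inverse t *\<^sub>R x \<in> V) at_top"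
    by (rule eventually_conj)
  then show ?thesis
    using eventually_happens'[OF trivial_limit_at_top_linorder] by blast
qed

text \<open>A one-sided bound suffices because it can be applied to multiples of
  \<open>y - x\<close> of either sign.\<close>

lemma linear_continuous_if_le_one:
  fixes F :: "'a::real_tvs \<Rightarrow> real"
  assumes "linear F" and nhd: "eventually (\<lambda>v. F v \<le> 1) (nhds 0)"
  shows "continuous_on UNIV F"
proof -
  have lim: "(F \<longlongrightarrow> F x) (nhds x)" for x
  proof (rule tendstoI)
    fix e :: real
    assume e: "e > 0"
    have bound: "eventually (\<lambda>y. F (c *\<^sub>R (y - x)) \<le> 1) (nhds x)" for c
    proof -
      have "((\<lambda>y. c *\<^sub>R (y - x)) \<longlongrightarrow> c *\<^sub>R (x - x)) (nhds x)"
        by (intro tendsto_scaleR_tvs tendsto_diff tendsto_const filterlim_ident)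
      with nhd show ?thesis by (auto dest: filterlim_iff[THEN iffD1])
    qed
    \<comment> \<open>The factor 2 gives a distance of at most \<open>e / 2\<close>, hence strictly
      less than \<open>e\<close>.\<close>
    from bound[of "2 / e"] bound[of "- (2 / e)"]
    show "eventually (\<lambda>y. dist (F y) (F x) < e) (nhds x)"
    proof eventually_elim
      case (elim y)
      then have "(2 / e) * (F y - F x) \<le> 1" "- (2 / e) * (F y - F x) \<le> 1"
        by (simp_all only: linear_cmul[OF assms(1)] linear_diff[OF assms(1)] real_scaleR_def)
      with e show ?case by (simp add: dist_real_def field_simps abs_if)
    qed
  qed
  show ?thesis
    unfolding continuous_on_def
    by (auto intro: tendsto_mono[OF _ lim] simp: at_within_def)
qed

text \<open>\<open>F\<close> supports the gauge of a convex neighbourhood \<open>K\<close> of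
  \<open>0\<close> at a point \<open>b\<close> outside \<open>K\<close>. Then
  \<open>F \<le> 1\<close> on \<open>K\<close> gives continuity, and together with
  \<open>1 \<le> F b\<close> it gives the separation.\<close>

theorem separating_functional_closure:
  fixes A :: "'z::real_lctvs set"
  assumes "convex A" "A \<noteq> {}" "z \<notin> closure A"
  obtains F e where "F \<in> topological_dual" "e > 0" "\<And>a. a \<in> A \<Longrightarrow> F z + e \<le> F a"
proof -
  obtain a0 where "a0 \<in> A" using assms(2) by blast
  define b where "b = a0 - z"
  have "eventually (\<lambda>y. y \<in> - closure A) (nhds z)"
    using assms(3) by (intro eventually_nhds_in_open) auto
  moreover have "((\<lambda>v. z + v) \<longlongrightarrow> z + 0) (nhds 0)"
    by (intro tendsto_add tendsto_const filterlim_ident)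
  ultimately have "eventually (\<lambda>v. v \<in> {v. z + v \<notin> closure A}) (nhds 0)"
    by (auto dest: filterlim_iff[THEN iffD1])
  from convex_nhds_zero[OF this] obtain V
    where V: "convex V" "eventually (\<lambda>v. v \<in> V) (nhds 0)" "\<And>v. v \<in> V \<Longrightarrow> z + v \<notin> closure A"
    by blast
  \<comment> \<open>This is \<open>a0 + V - A\<close>: translating by \<open>a0\<close> makes it
    contain \<open>V\<close>, and \<open>b \<in> K\<close> would mean that \<open>z + V\<close>
    meets \<open>A\<close>.\<close>
  define K where "K = (\<lambda>w. a0 + w) ` (\<Union>v\<in>V. \<Union>a\<in>A. {v - a})"
  have KI: "a0 + (v - a) \<in> K" if "v \<in> V" "a \<in> A" for v a
    using that by (auto simp: K_def)
  have "convex K"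
    unfolding K_def by (intro convex_translation convex_differences V(1) assms(1))
  have "V \<subseteq> K"
    using KI[OF _ \<open>a0 \<in> A\<close>] by auto
  have "0 \<in> V" using V(2) by (rule eventually_nhds_x_imp_x)
  have absorbing: "\<exists>t>0. inverse t *\<^sub>R x \<in> K" for x
    using eventually_nhds_zero_absorbing[OF V(2)] \<open>V \<subseteq> K\<close> by blast
  have "b \<notin> K"
  proof
    assume "b \<in> K"
    then obtain v a where "v \<in> V" "a \<in> A" "a0 - z = a0 + (v - a)"
      by (auto simp: K_def b_def)
    then have "z + v = a" by (simp add: algebra_simps)
    with V(3)[OF \<open>v \<in> V\<close>] \<open>a \<in> A\<close> closure_subset show False by blast
  qed
  obtain F where F: "linear F" "\<And>x. F x \<le> minkowski K x" "F b = minkowski K b"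
    using Hahn_Banach_supporting[OF sublinear_minkowski[OF \<open>convex K\<close> absorbing], of b] by blast
  have F_K: "F x \<le> 1" if "x \<in> K" for x
    using F(2)[of x] minkowski_le[of 1 x K] that by simp
  have F_b: "1 \<le> F b"
    unfolding F(3) using \<open>0 \<in> V\<close> \<open>V \<subseteq> K\<close> \<open>convex K\<close> \<open>b \<notin> K\<close> absorbing
    by (intro minkowski_ge_one) auto
  have "continuous_on UNIV F"
    using F(1) by (rule linear_continuous_if_le_one)
      (use F_K \<open>V \<subseteq> K\<close> in \<open>auto intro: eventually_mono[OF V(2)]\<close>)
  with F(1) have "F \<in> topological_dual" by (simp add: topological_dual_def)
  \<comment> \<open>The gap comes from this point of \<open>V\<close> on the ray through
    \<open>b\<close>: there \<open>F\<close> is at least \<open>inverse t\<close>, uniformly in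
    \<open>a\<close>.\<close>
  obtain t where t: "t > 0" "inverse t *\<^sub>R b \<in> V"
    using eventually_nhds_zero_absorbing[OF V(2)] by blast
  show thesis
  proof (rule that[of F "inverse t"])
    fix a
    assume "a \<in> A"
    have "F a0 + (F (inverse t *\<^sub>R b) - F a) \<le> F a0 - F z"
      using F_K[OF KI[OF t(2) \<open>a \<in> A\<close>]] F_b
      by (simp add: linear_add[OF F(1)] linear_diff[OF F(1)] b_def)
    then have "F z + F (inverse t *\<^sub>R b) \<le> F a" by simp
    moreover have "inverse t \<le> F (inverse t *\<^sub>R b)"
      using F_b t(1) by (simp add: linear_cmul[OF F(1)])
    ultimately show "F z + inverse t \<le> F a" by simp
  qed (use t(1) \<open>F \<in> topological_dual\<close> in auto)
qed

section \<open>Set-valued and scalar limits inferior\<close>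

lemma closed_convex_lattice_add:
  assumes "A \<in> closed_convex_lattice C" "a \<in> A" "c \<in> C"
  shows "a + c \<in> A"
proof -
  have "a + c \<in> closure (convex hull (A + C))"
    using assms(2,3) by (intro subsetD[OF closure_subset] hull_inc set_plus_intro)
  with assms(1) show ?thesis by (simp add: closed_convex_lattice_def)
qed

text \<open>If \<open>F c < 0\<close> for some \<open>c\<close> in \<open>C\<close>, moving from a
  point of \<open>A\<close> in direction \<open>c\<close> stays in \<open>A\<close> and makes
  \<open>F\<close> arbitrarily small.\<close>

lemma bounded_below_imp_dual_cone:
  assumes "convex_cone C" "F \<in> topological_dual"
    and A: "A \<in> closed_convex_lattice C" "A \<noteq> {}" and bound: "\<And>a. a \<in> A \<Longrightarrow> m \<le> F a"
  shows "F \<in> dual_cone C"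
proof -
  have lin: "linear F" using assms(2) by (simp add: topological_dual_def)
  obtain a where "a \<in> A" using A(2) by blast
  have "0 \<le> F c" if "c \<in> C" for c
  proof (rule ccontr)
    assume "\<not> 0 \<le> F c"
    then have neg: "F c < 0" by simp
    \<comment> \<open>Chosen so that \<open>F (a + t *\<^sub>R c)\<close> equals
      \<open>m - 1\<close>.\<close>
    define t where "t = (F a - m + 1) / (- F c)"
    have "t \<ge> 0" using bound[OF \<open>a \<in> A\<close>] neg unfolding t_def by (intro divide_nonneg_pos) simp_all
    then have "t *\<^sub>R c \<in> C"
      using assms(1) that by (auto simp: convex_cone_def conic_def)
    with A(1) \<open>a \<in> A\<close> have "a + t *\<^sub>R c \<in> A" by (rule closed_convex_lattice_add)
    from bound[OF this] have "m \<le> F a + t * F c"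
      by (simp add: linear_add[OF lin] linear_cmul[OF lin])
    moreover have "t * F c = - (F a - m + 1)" using neg by (simp add: t_def)
    ultimately show False by simp
  qed
  with assms(2) show ?thesis by (simp add: dual_cone_def)
qed

lemma nhd_base_zero_mem: "nhd_base_zero N \<Longrightarrow> U \<in> N \<Longrightarrow> x0 \<in> (+) x0 ` U"
  by (auto simp: nhd_base_zero_def image_iff dest: eventually_nhds_x_imp_x
      intro!: bexI[of _ 0])

lemma scalar_liminf_le:
  assumes "nhd_base_zero N"
  shows "scalar_liminf N g x0 \<le> g x0"
  unfolding scalar_liminf_def
  by (intro SUP_least INF_lower nhd_base_zero_mem[OF assms])

theorem corollary4p20:
  fixes N :: "'x::real_tvs set set"
    and C :: "'z::real_lctvs set"
    and f :: "'x \<Rightarrow> 'z set"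
    and x0 :: 'x
  assumes "nhd_base_zero N"
    and "\<exists>z::'z. z \<noteq> 0"
    and "convex_cone C" and "0 \<in> C"
    and "\<And>x. f x \<in> closed_convex_lattice C"
    and "x0 \<in> domain_of f"
    and "lattice_lsc_at N f x0"
  shows "set_liminf N f x0 =
    {z. \<forall>zs \<in> dual_cone C - {\<lambda>_. 0}.
          scalar_liminf N (scalarization f zs) x0 \<le> ereal (zs z)}"
proof (intro equalityI subsetI CollectI ballI)
  fix z zs
  assume "z \<in> set_liminf N f x0"
  with assms(7) have "z \<in> f x0" by (auto simp: lattice_lsc_at_def)
  then have "scalarization f zs x0 \<le> ereal (zs z)"
    unfolding scalarization_def by (rule INF_lower)
  with scalar_liminf_le[OF assms(1)]
  show "scalar_liminf N (scalarization f zs) x0 \<le> ereal (zs z)"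
    by (rule order_trans)
next
  fix z
  assume z: "z \<in> {z. \<forall>zs \<in> dual_cone C - {\<lambda>_. 0}.
    scalar_liminf N (scalarization f zs) x0 \<le> ereal (zs z)}"
  show "z \<in> set_liminf N f x0"
    unfolding set_liminf_def
  proof (intro INT_I, rule ccontr)
    fix U
    assume U: "U \<in> N"
    let ?A = "\<Union>x\<in>(+) x0 ` U. f x"
    assume notin: "z \<notin> closure (convex hull ?A)"
    have f_x0: "f x0 \<noteq> {}" "f x0 \<subseteq> ?A"
      using assms(6) nhd_base_zero_mem[OF assms(1) U, of x0] by (auto simp: domain_of_def)
    then have "convex hull ?A \<noteq> {}" using hull_subset[of ?A convex] by blast
    from separating_functional_closure[OF convex_convex_hull this notin] obtain F e
      where F: "F \<in> topological_dual" "e > 0" "\<And>a. a \<in> convex hull ?A \<Longrightarrow> F z + e \<le> F a"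
      by blast
    have sep: "F z + e \<le> F a" if "a \<in> ?A" for a
      using that by (intro F(3) hull_inc)
    \<comment> \<open>The separation is used here only on \<open>f x0\<close>, a nonempty member of
      the lattice on which \<open>F\<close> is bounded below by \<open>F z + e\<close>.\<close>
    have "F \<in> dual_cone C"
      using assms(3) F(1) assms(5) f_x0(1)
      by (rule bounded_below_imp_dual_cone) (use sep f_x0(2) in blast)
    \<comment> \<open>For zero \<open>F\<close>, the inequality \<open>sep\<close> at a point of
      \<open>f x0\<close> would give \<open>e \<le> 0\<close>.\<close>
    moreover have "F \<noteq> (\<lambda>_. 0)"
      using sep f_x0 F(2) by fastforce
    ultimately have "scalar_liminf N (scalarization f F) x0 \<le> ereal (F z)"
      using z by blast
    \<comment> \<open>Points with empty \<open>f x\<close> contribute \<infinity> and do no harm;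
      the right-hand side is one term of the supremum defining \<open>scalar_liminf\<close>.\<close>
    moreover have "ereal (F z + e) \<le> (INF x\<in>(+) x0 ` U. scalarization f F x)"
      unfolding scalarization_def using sep by (intro INF_greatest) auto
    moreover have "\<dots> \<le> scalar_liminf N (scalarization f F) x0"
      unfolding scalar_liminf_def by (rule SUP_upper[OF U])
    ultimately have "ereal (F z + e) \<le> ereal (F z)" by (blast intro: order_trans)
    with F(2) show False by simp
  qed
qed

end
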